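(* Let $d\ge 2$, $\mathbf{n}=(n_1,\dots,n_d)\in\mathbb{N}^d$, $n=\prod_{i=1}^d n_i$, and let $\mathcal{B}\in\mathcal{S}_{\mathbf{n}}^+$. Let $\{\mathcal{P}_i\}_{i=1}^{n_1}$ be the sequence of block lumped matrices constructed from $\mathcal{B}$. Then: 1. $\Lambda(\mathcal{B},\mathcal{P}_i)\subset(0,1]$ for all $i=1,\dots,n_1$; 2. $\lambda_k(\mathcal{B},\mathcal{P}_i)\le\lambda_k(\mathcal{B},\mathcal{P}_{i+1})$ for all $k=1,\dots,n$ and any given $i=1,\dots,n_1-1$; 3. $\lambda_n(\mathcal{B},\mathcal{P}_i)=1$ for all $i=1,\dots,n_1$.
   Context: All matrices are real. For symmetric matrices $A,B$ of equal size, $A\succeq B$ (resp. $A\succ B$) means that $A-B$ is positive semidefinite (resp. positive definite). For symmetric $A$ and symmetric positive definite $B$ of size $n$, $\Lambda(A,B)$ is the set of generalized eigenvalues, i.e. the $\lambda$ with $A\mathbf{x}=\lambda B\mathbf{x}$ for some $\mathbf{x}\ne 0$; they are ordered increasingly with multiplicity, $\lambda_1(A,B)\le\dots\le\lambda_n(A,B)$. Sets $\mathcal{S}_{\mathbf{n}}$, $\mathcal{S}_{\mathbf{n}}^+$. For a positive integer $m$, $\mathcal{S}_m=\{B\in\mathbb{R}^{m\times m}: B=B^T,\ B\succeq 0\}$ and $\mathcal{S}_m^+=\{B\in\mathbb{R}^{m\times m}: B=B^T,\ B\succ 0\}$; for a vector $(m)$ of length one, $\mathcal{S}_{(m)}=\mathcal{S}_m$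 and $\mathcal{S}_{(m)}^+=\mathcal{S}_m^+$. For $d\ge2$, $\mathbf{n}=(n_1,\dots,n_d)$ (positive integers), $n=\prod_{i=1}^d n_i$ and $r_1=\prod_{j=2}^d n_j$, partition $\mathcal{B}\in\mathbb{R}^{n\times n}$ into $n_1\times n_1$ blocks $B_{i,j}\in\mathbb{R}^{r_1\times r_1}$. Recursively, $\mathcal{S}_{(n_1,\dots,n_d)}=\{\mathcal{B}\in\mathcal{S}_n: B_{i,j}\in\mathcal{S}_{(n_2,\dots,n_d)}\ \forall i,j\}$ and $\mathcal{S}_{(n_1,\dots,n_d)}^+=\{\mathcal{B}\in\mathcal{S}_n^+: B_{i,j}\in\mathcal{S}_{(n_2,\dots,n_d)}\ \forall i,j\}$. Block lumping operator. For any block matrix $\mathcal{B}$ partitioned into $n_1\times n_1$ blocks $B_{i,j}\in\mathbb{R}^{r_1\times r_1}$, $\mathcal{L}(\mathcal{B})$ is the block diagonal matrix $\operatorname{diag}(D_1,\dots,D_{n_1})$ with $D_i=\sum_{j=1}^{n_1}B_{i,j}$. Block lumped matrices. For $i=1,\dots,n_1$ write $\mathcal{B}=\mathcal{D}_i+\mathcal{R}_i$, where $\mathcal{D}_i$ consists of all super and sub block diagonals strictly smaller than $i$ (i.e. $\mathcal{D}_i$ keeps the blocks $B_{k,l}$ with $|k-l|<i$ and is zero elsewhere), and $\mathcal{R}_i=\mathcal{B}-\mathcal{D}_i$ is the remainder. Then $\mathcal{P}_i=\mathcal{D}_i+\mathcal{L}(\mathcal{R}_i)$. In particular $\mathcal{P}_1=\mathcal{L}(\mathcal{B})$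 and $\mathcal{P}_{n_1}=\mathcal{B}$. *)

theory Defs
  imports "Jordan_Normal_Form.Char_Poly"
begin

definition pos_semidef :: "real mat \<Rightarrow> bool" where
  "pos_semidef A \<longleftrightarrow> (\<forall>x \<in> carrier_vec (dim_col A). 0 \<le> x \<bullet> (A *\<^sub>v x))"

definition pos_def :: "real mat \<Rightarrow> bool" where
  "pos_def A \<longleftrightarrow> (\<forall>x \<in> carrier_vec (dim_col A). x \<noteq> 0\<^sub>v (dim_col A) \<longrightarrow> 0 < x \<bullet> (A *\<^sub>v x))"

definition sym_psd :: "nat \<Rightarrow> real mat set" where
  "sym_psd m = {B \<in> carrier_mat m m. B = transpose_mat B \<and> pos_semidef B}"

definition sym_pd :: "nat \<Rightarrow> real mat set" where
  "sym_pd m = {B \<in> carrier_mat m m. B = transpose_mat B \<and> pos_def B}"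

text \<open>All indices start at 0, both for blocks and for entries.\<close>

definition block :: "nat \<Rightarrow> 'a mat \<Rightarrow> nat \<Rightarrow> nat \<Rightarrow> 'a mat" where
  "block r B i j = mat r r (\<lambda>(k, l). B $$ (i * r + k, j * r + l))"

text \<open>Size vectors have positive length; the value at \<^term>\<open>[]\<close> is a dummy.\<close>

fun S_psd :: "nat list \<Rightarrow> real mat set" where
  "S_psd [] = {}"
| "S_psd [m] = sym_psd m"
| "S_psd (m # m' # ns) =
     {B \<in> sym_psd (prod_list (m # m' # ns)).
        \<forall>i<m. \<forall>j<m. block (prod_list (m' # ns)) B i j \<in> S_psd (m' # ns)}"

text \<open>Only the full matrix is required to be positive definite; the blocks are merely
  semidefinite, so \<^term>\<open>S_psd\<close> on the right-hand side is intended.\<close>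

fun S_pd :: "nat list \<Rightarrow> real mat set" where
  "S_pd [] = {}"
| "S_pd [m] = sym_pd m"
| "S_pd (m # m' # ns) =
     {B \<in> sym_pd (prod_list (m # m' # ns)).
        \<forall>i<m. \<forall>j<m. block (prod_list (m' # ns)) B i j \<in> S_psd (m' # ns)}"

text \<open>In what follows, \<open>m\<close> is the number of block rows and \<open>r\<close> the size of a block.\<close>

definition block_lump :: "nat \<Rightarrow> nat \<Rightarrow> real mat \<Rightarrow> real mat" where
  "block_lump m r B =
     diag_block_mat (map (\<lambda>i. mat r r (\<lambda>kl. \<Sum>j<m. block r B i j $$ kl)) [0..<m])"

definition block_band :: "nat \<Rightarrow> nat \<Rightarrow> real mat \<Rightarrow> nat \<Rightarrow> real mat" where
  "block_band m r B i = mat (m * r) (m * r)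
     (\<lambda>(k, l). if \<bar>int (k div r) - int (l div r)\<bar> < int i then B $$ (k, l) else 0)"

definition block_lumped :: "nat \<Rightarrow> nat \<Rightarrow> real mat \<Rightarrow> nat \<Rightarrow> real mat" where
  "block_lumped m r B i = block_band m r B i + block_lump m r (B - block_band m r B i)"

definition gen_eigenvalues :: "real mat \<Rightarrow> real mat \<Rightarrow> real set" where
  "gen_eigenvalues A B =
     {c. \<exists>x \<in> carrier_vec (dim_col A). x \<noteq> 0\<^sub>v (dim_col A) \<and> A *\<^sub>v x = c \<cdot>\<^sub>v (B *\<^sub>v x)}"

text \<open>The polynomial \<open>det (X B - A)\<close>, which is the characteristic polynomial of \<open>A\<close>
  when \<open>B\<close> is the identity.\<close>

definition pencil_poly :: "real mat \<Rightarrow> real mat \<Rightarrow> real poly" where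
  "pencil_poly A B = det (map_mat (\<lambda>b. [:0, b:]) B + map_mat (\<lambda>a. [:- a:]) A)"

lemma pencil_poly_one:
  assumes "A \<in> carrier_mat n n"
  shows "pencil_poly A (1\<^sub>m n) = char_poly A"
proof -
  have "map_mat (\<lambda>b :: real. [:0, b:]) (1\<^sub>m n) = [:0, 1:] \<cdot>\<^sub>m 1\<^sub>m n"
    by (rule eq_matI) (auto simp: one_pCons)
  with assms show ?thesis
    unfolding pencil_poly_def char_poly_def char_poly_matrix_def by auto
qed

lemma gen_eigenvalues_eq_roots:
  assumes A: "A \<in> carrier_mat n n" and B: "B \<in> carrier_mat n n"
  shows "gen_eigenvalues A B = {x. poly (pencil_poly A B) x = 0}"
proof -
  have root: "poly (pencil_poly A B) x = det (x \<cdot>\<^sub>m B - A)" for x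
    unfolding pencil_poly_def by (rule poly_det_cong[of _ n]) (use A B in auto)
  have vec: "(x \<cdot>\<^sub>m B - A) *\<^sub>v v = 0\<^sub>v n \<longleftrightarrow> A *\<^sub>v v = x \<cdot>\<^sub>v (B *\<^sub>v v)"
    if v: "v \<in> carrier_vec n" for x v
  proof -
    have "(x \<cdot>\<^sub>m B - A) *\<^sub>v v = x \<cdot>\<^sub>v (B *\<^sub>v v) - A *\<^sub>v v"
      using A B v by (intro eq_vecI)
        (auto simp: scalar_prod_def sum_subtractf sum_distrib_left algebra_simps)
    moreover have "x \<cdot>\<^sub>v (B *\<^sub>v v) - A *\<^sub>v v = 0\<^sub>v n \<longleftrightarrow> A *\<^sub>v v = x \<cdot>\<^sub>v (B *\<^sub>v v)"
      using A B v by (auto simp: vec_eq_iff)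
    ultimately show ?thesis by simp
  qed
  have carr: "x \<cdot>\<^sub>m B - A \<in> carrier_mat n n" for x
    using A B by auto
  show ?thesis
    unfolding gen_eigenvalues_def root
    using A det_0_iff_vec_prod_zero[OF carr] vec by fastforce
qed

text \<open>The generalized eigenvalues in increasing order, repeated according to multiplicity, i.e.
  according to their order as a root of \<^term>\<open>pencil_poly A B\<close>. For symmetric \<open>A\<close> and symmetric
  positive definite \<open>B\<close> of size \<open>n\<close> this list has length \<open>n\<close>.
  The index \<open>k\<close> of \<open>gen_eigenvalue\<close> starts at 1.\<close>

definition gen_eigenvalue_list :: "real mat \<Rightarrow> real mat \<Rightarrow> real list" where
  "gen_eigenvalue_list A B = sorted_list_of_multiset (proots (pencil_poly A B))"

definition gen_eigenvalue :: "nat \<Rightarrow> real mat \<Rightarrow> real mat \<Rightarrow> real" where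
  "gen_eigenvalue k A B = gen_eigenvalue_list A B ! (k - 1)"

end

theory Submission
  imports Defs "Jordan_Normal_Form.Spectral_Radius"
begin

text \<open>
Write \<open>B k l\<close> for the blocks of \<open>B\<close> and \<open>X k\<close> for the blocks of a
vector \<open>x\<close>. Since \<open>B\<close> and all its blocks are symmetric, \<open>B k l = B l k\<close>, and lumping changes
the quadratic form of \<open>B\<close> by the forms of the far blocks at differences of blocks of \<open>x\<close> (lemma \<open>block_lumped_quad_form\<close>):
\<open>x \<bullet> (P i *\<^sub>v x) = x \<bullet> (B *\<^sub>v x) + 1/2 * (\<Sum> (X k - X l) \<bullet> (B k l *\<^sub>v (X k - X l)))\<close>, where the
sum runs over the pairs of blocks with \<open>\<bar>k - l\<bar> \<ge> i\<close>. The blocks are positive semidefinite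
by the outermost level of the recursive structure of \<open>B\<close>, so
\<open>B \<le> P (i + 1) \<le> P i\<close> in the order of quadratic forms. In particular all \<open>P i\<close> are positive definite.

The three claims follow. Rayleigh quotients of \<open>(B, P i)\<close> lie in the interval from 0 (excluded) to 1, hence so do
the eigenvalues. The all-ones vector has the same image under \<open>B\<close> and \<open>P i\<close>, as lumping keeps row
sums, so 1 is attained and is the largest eigenvalue. Finally, enlarging the second matrix of a pencil
whose first matrix is positive semidefinite cannot raise any eigenvalue (lemma \<open>gen_eigenvalue_antimono\<close>), which gives the monotonicity in \<open>i\<close>.

The last step concerns eigenvalues counted as roots of the pencil polynomial. The connection with quadratic forms is
made by simultaneously diagonalizing the two matrices (lemma \<open>simultaneous_diagonalization\<close>), after
which the eigenvalue list is the sorted diagonal, and the comparison of two pencils is a count of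
dimensions.\<close>

section \<open>Simultaneous diagonalization of a definite pencil\<close>

lemma sym_bilinear:
  fixes A :: "real mat"
  assumes "A \<in> carrier_mat n n" "A = transpose_mat A" "x \<in> carrier_vec n" "y \<in> carrier_vec n"
  shows "x \<bullet> (A *\<^sub>v y) = y \<bullet> (A *\<^sub>v x)"
proof -
  have "x \<bullet> (A *\<^sub>v y) = (transpose_mat A *\<^sub>v x) \<bullet> y"
    using transpose_vec_mult_scalar[of A n n y x] assms by simp
  also have "\<dots> = (A *\<^sub>v x) \<bullet> y" using assms(2) by simp
  also have "\<dots> = y \<bullet> (A *\<^sub>v x)" using assms by (intro comm_scalar_prod[of _ n]) auto
  finally show ?thesis .
qed

lemma pos_def_mult_eq_0_iff:
  assumes "B \<in> carrier_mat n n" "pos_def B" "x \<in> carrier_vec n" "B *\<^sub>v x = 0\<^sub>v n"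
  shows "x = 0\<^sub>v n"
  using assms by (force simp: pos_def_def)

lemma pos_def_right_inverse:
  assumes B: "B \<in> carrier_mat n n" and pd: "pos_def B"
  obtains C where "C \<in> carrier_mat n n" "B * C = 1\<^sub>m n"
proof -
  have "det B \<noteq> 0"
    using det_0_iff_vec_prod_zero[OF B] pos_def_mult_eq_0_iff[OF B pd] by blast
  from det_non_zero_imp_unit[OF B this]
  obtain C where "C \<in> carrier_mat n n" "B * C = 1\<^sub>m n"
    unfolding Units_def by (auto simp: ring_mat_simps)
  then show ?thesis using that by blast
qed

text \<open>Since \<open>B\<close> is invertible, \<open>B\<inverse> A\<close> has a complex eigenvalue. It is real by the usual
argument for Hermitian forms, carried out on the real and imaginary parts of an eigenvector; then one of
these parts is a real eigenvector.\<close>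

lemma exists_real_gen_eigenvector:
  fixes A B :: "real mat"
  assumes A: "A \<in> carrier_mat n n" "A = transpose_mat A"
    and B: "B \<in> carrier_mat n n" "B = transpose_mat B" "pos_def B" and n: "n > 0"
  obtains c x where "x \<in> carrier_vec n" "x \<noteq> 0\<^sub>v n" "A *\<^sub>v x = c \<cdot>\<^sub>v (B *\<^sub>v x)"
proof -
  obtain C where C: "C \<in> carrier_mat n n" "B * C = 1\<^sub>m n"
    using pos_def_right_inverse[OF B(1,3)] by blast
  define M where "M = C * A"
  have M: "M \<in> carrier_mat n n" unfolding M_def using C A by simp
  have BM: "B * M = A" unfolding M_def
    using assoc_mult_mat[of B n n C n A n] A B C by simp
  let ?M = "map_mat complex_of_real M"
  have "?M \<in> carrier_mat n n" using M by simp
  from spectrum_non_empty[OF this n] obtain c v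
    where ev: "eigenvector ?M v c" unfolding spectrum_def eigenvalue_def by auto
  then have v: "v \<in> carrier_vec n" "v \<noteq> 0\<^sub>v n" and eq: "?M *\<^sub>v v = c \<cdot>\<^sub>v v"
    unfolding eigenvector_def using M by auto
  define a where "a = map_vec Re v"
  define b where "b = map_vec Im v"
  have ab: "a \<in> carrier_vec n" "b \<in> carrier_vec n" unfolding a_def b_def using v by auto
  have comp: "(\<Sum>j<n. of_real (M $$ (i,j)) * v $ j) = c * v $ i" if "i < n" for i
    using arg_cong[OF eq, of "\<lambda>u. u $ i"] that v M
    by (simp add: scalar_prod_def atLeast0LessThan)
  have Ma: "M *\<^sub>v a = Re c \<cdot>\<^sub>v a - Im c \<cdot>\<^sub>v b"
  proof (rule eq_vecI)
    fix i assume "i < dim_vec (Re c \<cdot>\<^sub>v a - Im c \<cdot>\<^sub>v b)"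
    then have i: "i < n" using ab by simp
    show "(M *\<^sub>v a) $ i = (Re c \<cdot>\<^sub>v a - Im c \<cdot>\<^sub>v b) $ i"
      using arg_cong[OF comp[OF i], of Re] i v M ab
      by (simp add: scalar_prod_def atLeast0LessThan a_def b_def)
  qed (use M ab in auto)
  have Mb: "M *\<^sub>v b = Im c \<cdot>\<^sub>v a + Re c \<cdot>\<^sub>v b"
  proof (rule eq_vecI)
    fix i assume "i < dim_vec (Im c \<cdot>\<^sub>v a + Re c \<cdot>\<^sub>v b)"
    then have i: "i < n" using ab by simp
    show "(M *\<^sub>v b) $ i = (Im c \<cdot>\<^sub>v a + Re c \<cdot>\<^sub>v b) $ i"
      using arg_cong[OF comp[OF i], of Im] i v M ab
      by (simp add: scalar_prod_def atLeast0LessThan a_def b_def algebra_simps)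
  qed (use M ab in auto)
  have Aa: "A *\<^sub>v a = Re c \<cdot>\<^sub>v (B *\<^sub>v a) - Im c \<cdot>\<^sub>v (B *\<^sub>v b)"
    using assoc_mult_mat_vec[of B n n M n a] BM Ma B(1) M ab
    by (simp add: mult_minus_distrib_mat_vec[of B n n] mult_mat_vec[of B n n])
  have Ab: "A *\<^sub>v b = Im c \<cdot>\<^sub>v (B *\<^sub>v a) + Re c \<cdot>\<^sub>v (B *\<^sub>v b)"
    using assoc_mult_mat_vec[of B n n M n b] BM Mb B(1) M ab
    by (simp add: mult_add_distrib_mat_vec[of B n n] mult_mat_vec[of B n n])
  have nz: "a \<noteq> 0\<^sub>v n \<or> b \<noteq> 0\<^sub>v n"
  proof (rule ccontr)
    assume *: "\<not> ?thesis"
    have "v = 0\<^sub>v n"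
    proof (rule eq_vecI)
      fix i assume i: "i < dim_vec (0\<^sub>v n :: complex vec)"
      have "a $ i = 0" "b $ i = 0" using * i by auto
      then show "v $ i = (0\<^sub>v n) $ i" using i v by (simp add: a_def b_def complex_eq_iff)
    qed (use v in auto)
    then show False using v by simp
  qed
  have Bc: "B *\<^sub>v a \<in> carrier_vec n" "B *\<^sub>v b \<in> carrier_vec n" using B ab by auto
  have e1: "b \<bullet> (A *\<^sub>v a) = Re c * (b \<bullet> (B *\<^sub>v a)) - Im c * (b \<bullet> (B *\<^sub>v b))"
    unfolding Aa using ab Bc by (simp add: scalar_prod_minus_distrib[of _ n])
  have e2: "a \<bullet> (A *\<^sub>v b) = Im c * (a \<bullet> (B *\<^sub>v a)) + Re c * (a \<bullet> (B *\<^sub>v b))"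
    unfolding Ab using ab Bc by (simp add: scalar_prod_add_distrib[of _ n])
  \<comment> \<open>The two mixed terms agree by symmetry, so comparing their expansions isolates the imaginary part.\<close>
  have "Im c * (a \<bullet> (B *\<^sub>v a) + b \<bullet> (B *\<^sub>v b)) = 0"
    using e1 e2 sym_bilinear[OF A ab] sym_bilinear[OF B(1,2) ab] by (simp add: algebra_simps)
  moreover have "a \<bullet> (B *\<^sub>v a) + b \<bullet> (B *\<^sub>v b) > 0"
  proof -
    have nn: "x \<bullet> (B *\<^sub>v x) \<ge> 0" if "x \<in> carrier_vec n" for x
      using B that unfolding pos_def_def by (cases "x = 0\<^sub>v n") (auto intro: less_imp_le)
    show ?thesis using nz B ab nn[OF ab(1)] nn[OF ab(2)] unfolding pos_def_def
      by (metis add_nonneg_pos add_pos_nonneg carrier_matD(2))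
  qed
  ultimately have "Im c = 0" by auto
  then have "A *\<^sub>v a = Re c \<cdot>\<^sub>v (B *\<^sub>v a)" "A *\<^sub>v b = Re c \<cdot>\<^sub>v (B *\<^sub>v b)"
    unfolding Aa Ab using Bc by (auto intro!: eq_vecI)
  then show ?thesis using nz that ab by blast
qed

text \<open>A basis of the hyperplane orthogonal to \<open>w\<close>, as the columns of \<open>W\<close>: if \<open>w $ p \<noteq> 0\<close>, the
coordinates other than \<open>p\<close> are free and determine coordinate \<open>p\<close>. Restricting a quadratic form to the
hyperplane then amounts to the congruence by \<open>W\<close>, which lowers the size of the matrices by one.\<close>

lemma hyperplane_parametrization:
  fixes w :: "real vec"
  assumes w: "w \<in> carrier_vec (Suc m)" "w \<noteq> 0\<^sub>v (Suc m)"
  obtains W where "W \<in> carrier_mat (Suc m) m"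
    "\<And>y. y \<in> carrier_vec m \<Longrightarrow> w \<bullet> (W *\<^sub>v y) = 0"
    "\<And>y. y \<in> carrier_vec m \<Longrightarrow> W *\<^sub>v y = 0\<^sub>v (Suc m) \<Longrightarrow> y = 0\<^sub>v m"
proof -
  obtain p where p: "p < Suc m" "w $ p \<noteq> 0"
    using w by (metis eq_vecI carrier_vecD index_zero_vec)
  \<comment> \<open>The increasing enumeration of the coordinates other than p.\<close>
  define s where "s i = (if i < p then i else Suc i)" for i
  have s: "s i < Suc m" "s i \<noteq> p" if "i < m" for i using that p by (auto simp: s_def)
  have inj: "s i = s j \<longleftrightarrow> i = j" for i j by (auto simp: s_def)
  define W where "W = mat (Suc m) m
    (\<lambda>(k, i). if k = s i then 1 else if k = p then - w $ s i / w $ p else 0)"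
  have W: "W \<in> carrier_mat (Suc m) m" by (simp add: W_def)
  have row: "(W *\<^sub>v y) $ s i = y $ i" if "y \<in> carrier_vec m" "i < m" for y i
  proof -
    have "(W *\<^sub>v y) $ s i = (\<Sum>j<m. W $$ (s i, j) * y $ j)"
      using that W s by (simp add: scalar_prod_def atLeast0LessThan)
    also have "\<dots> = (\<Sum>j<m. if i = j then y $ j else 0)"
      using that s by (intro sum.cong) (auto simp: W_def inj)
    finally show ?thesis using that by simp
  qed
  have col: "w \<bullet> col W i = 0" if i: "i < m" for i
  proof -
    have "w \<bullet> col W i = (\<Sum>k<Suc m. w $ k * W $$ (k, i))"
      using W i by (simp add: scalar_prod_def atLeast0LessThan)
    also have "\<dots> = (\<Sum>k\<in>{s i, p}. w $ k * W $$ (k, i))"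
      using i s[OF i] p by (intro sum.mono_neutral_right) (auto simp: W_def)
    also have "\<dots> = 0" using s[OF i] p i by (simp add: W_def)
    finally show ?thesis .
  qed
  have "w \<bullet> (W *\<^sub>v y) = 0" if y: "y \<in> carrier_vec m" for y
  proof -
    have "transpose_mat W *\<^sub>v w = 0\<^sub>v m"
      using W w col by (intro eq_vecI) (auto simp: comm_scalar_prod[of w "Suc m"])
    then show ?thesis using transpose_vec_mult_scalar[OF W y w(1)] y by simp
  qed
  moreover have "y = 0\<^sub>v m" if "y \<in> carrier_vec m" "W *\<^sub>v y = 0\<^sub>v (Suc m)" for y
  proof (rule eq_vecI)
    fix i assume i: "i < dim_vec (0\<^sub>v m :: real vec)"
    then show "y $ i = 0\<^sub>v m $ i" using row[OF that(1), of i] that s[of i] by simp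
  qed (use that in auto)
  ultimately show ?thesis using that[OF W] by blast
qed

text \<open>Induction by deflation. If \<open>x\<close> is a normalized generalized eigenvector, the \<open>B\<close>-orthogonal complement
of \<open>x\<close> is the hyperplane orthogonal to \<open>B *\<^sub>v x\<close>. As \<open>A *\<^sub>v x\<close> is a multiple of \<open>B *\<^sub>v x\<close>, this
complement is also orthogonal to \<open>A *\<^sub>v x\<close>, so the problem splits into \<open>x\<close> and the same problem on the
complement.\<close>

lemma exists_orthonormal_gen_eigenvectors:
  fixes A B :: "real mat"
  assumes "A \<in> carrier_mat n n" "A = transpose_mat A"
    and "B \<in> carrier_mat n n" "B = transpose_mat B" "pos_def B"
  shows "\<exists>v d. (\<forall>i<n. v i \<in> carrier_vec n) \<and>
    (\<forall>i<n. \<forall>j<n. v i \<bullet> (B *\<^sub>v v j) = (if i = j then 1 else 0)) \<and>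
    (\<forall>i<n. \<forall>j<n. v i \<bullet> (A *\<^sub>v v j) = (if i = j then d j else 0))"
  using assms
proof (induction n arbitrary: A B)
  case 0
  then show ?case by simp
next
  case (Suc m)
  note A = Suc.prems(1,2) and B = Suc.prems(3-5)
  obtain c x0 where x0: "x0 \<in> carrier_vec (Suc m)" "x0 \<noteq> 0\<^sub>v (Suc m)" "A *\<^sub>v x0 = c \<cdot>\<^sub>v (B *\<^sub>v x0)"
    using exists_real_gen_eigenvector[OF A B zero_less_Suc] by metis
  define g where "g = x0 \<bullet> (B *\<^sub>v x0)"
  have g: "g > 0" unfolding g_def using B x0 by (auto simp: pos_def_def)
  define x where "x = (1 / sqrt g) \<cdot>\<^sub>v x0"
  have x: "x \<in> carrier_vec (Suc m)" unfolding x_def using x0 by simp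
  have Bx0: "B *\<^sub>v x0 \<in> carrier_vec (Suc m)" and Bx: "B *\<^sub>v x \<in> carrier_vec (Suc m)"
    using B x0 x by auto
  have Bx_eq: "B *\<^sub>v x = (1 / sqrt g) \<cdot>\<^sub>v (B *\<^sub>v x0)"
    unfolding x_def using B(1) x0 by (simp add: mult_mat_vec[of B "Suc m" "Suc m"])
  have Ax: "A *\<^sub>v x = c \<cdot>\<^sub>v (B *\<^sub>v x)"
    unfolding x_def using A(1) B(1) x0
    by (simp add: mult_mat_vec[of _ "Suc m" "Suc m"] smult_smult_assoc mult.commute)
  have xBx: "x \<bullet> (B *\<^sub>v x) = 1"
    unfolding Bx_eq using x0 Bx0 g by (simp add: x_def g_def[symmetric] field_simps)
  have "x \<noteq> 0\<^sub>v (Suc m)" using xBx Bx by auto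
  then have w: "B *\<^sub>v x \<noteq> 0\<^sub>v (Suc m)" using pos_def_mult_eq_0_iff[OF B(1,3) x] by auto
  obtain W where W: "W \<in> carrier_mat (Suc m) m"
    "\<And>y. y \<in> carrier_vec m \<Longrightarrow> (B *\<^sub>v x) \<bullet> (W *\<^sub>v y) = 0"
    "\<And>y. y \<in> carrier_vec m \<Longrightarrow> W *\<^sub>v y = 0\<^sub>v (Suc m) \<Longrightarrow> y = 0\<^sub>v m"
    using hyperplane_parametrization[OF Bx w] by blast
  \<comment> \<open>The restriction of the bilinear form of M to the complement.\<close>
  define cg where "cg M = transpose_mat W * (M * W)" for M :: "real mat"
  have cg_carrier: "cg M \<in> carrier_mat m m" if "M \<in> carrier_mat (Suc m) (Suc m)" for M
    using that W unfolding cg_def by auto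
  have cg_sym: "cg M = transpose_mat (cg M)"
    if "M \<in> carrier_mat (Suc m) (Suc m)" "M = transpose_mat M" for M
  proof -
    have "transpose_mat (cg M) = transpose_mat (M * W) * transpose_mat (transpose_mat W)"
      unfolding cg_def using that W by (intro transpose_mult[of _ m "Suc m" _ m]) auto
    also have "\<dots> = (transpose_mat W * transpose_mat M) * W"
      using that W by (simp add: transpose_mult[of M "Suc m" "Suc m" W m])
    also have "\<dots> = cg M"
      unfolding cg_def using that W(1) assoc_mult_mat[of "transpose_mat W" m "Suc m" M "Suc m" W m]
      by simp
    finally show ?thesis by simp
  qed
  have cg_form: "y \<bullet> (cg M *\<^sub>v z) = (W *\<^sub>v y) \<bullet> (M *\<^sub>v (W *\<^sub>v z))"
    if "M \<in> carrier_mat (Suc m) (Suc m)" "y \<in> carrier_vec m" "z \<in> carrier_vec m" for M y z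
  proof -
    have 1: "cg M *\<^sub>v z = transpose_mat W *\<^sub>v (M *\<^sub>v (W *\<^sub>v z))"
      unfolding cg_def using that W(1)
      by (simp add: assoc_mult_mat_vec[of _ m "Suc m" _ m] assoc_mult_mat_vec[of M "Suc m" "Suc m" W m])
    have u: "M *\<^sub>v (W *\<^sub>v z) \<in> carrier_vec (Suc m)" "W *\<^sub>v y \<in> carrier_vec (Suc m)"
      "transpose_mat W *\<^sub>v (M *\<^sub>v (W *\<^sub>v z)) \<in> carrier_vec m"
      using that W(1) by auto
    show ?thesis unfolding 1
      using transpose_vec_mult_scalar[OF W(1) that(2) u(1)] comm_scalar_prod[OF u(3) that(2)]
        comm_scalar_prod[OF u(1,2)] by simp
  qed
  have "pos_def (cg B)"
    unfolding pos_def_def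
  proof (intro ballI impI)
    fix y :: "real vec" assume "y \<in> carrier_vec (dim_col (cg B))" "y \<noteq> 0\<^sub>v (dim_col (cg B))"
    then have y: "y \<in> carrier_vec m" "y \<noteq> 0\<^sub>v m" using cg_carrier[OF B(1)] by auto
    have "W *\<^sub>v y \<noteq> 0\<^sub>v (Suc m)" "W *\<^sub>v y \<in> carrier_vec (Suc m)" using W y by auto
    then show "0 < y \<bullet> (cg B *\<^sub>v y)"
      using cg_form[OF B(1) y(1) y(1)] B unfolding pos_def_def by auto
  qed
  from Suc.IH[OF cg_carrier[OF A(1)] cg_sym[OF A] cg_carrier[OF B(1)] cg_sym[OF B(1,2)] this]
  obtain v d where v: "\<And>i. i < m \<Longrightarrow> v i \<in> carrier_vec m"
    and vB: "\<And>i j. i < m \<Longrightarrow> j < m \<Longrightarrow> v i \<bullet> (cg B *\<^sub>v v j) = (if i = j then 1 else 0)"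
    and vA: "\<And>i j. i < m \<Longrightarrow> j < m \<Longrightarrow> v i \<bullet> (cg A *\<^sub>v v j) = (if i = j then d j else 0)"
    by blast
  define u where "u i = (case i of 0 \<Rightarrow> x | Suc j \<Rightarrow> W *\<^sub>v v j)" for i
  define e where "e i = (case i of 0 \<Rightarrow> c | Suc j \<Rightarrow> d j)" for i
  have u: "u i \<in> carrier_vec (Suc m)" if "i < Suc m" for i
    using that x W v by (cases i) (auto simp: u_def)
  have u0: "u 0 = x" and uS: "u (Suc i) = W *\<^sub>v v i" for i by (auto simp: u_def)
  have orth: "(W *\<^sub>v v i) \<bullet> (B *\<^sub>v x) = 0" if "i < m" for i
    using W(2)[OF v[OF that]] comm_scalar_prod[OF Bx, of "W *\<^sub>v v i"] u[of "Suc i"] that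
    by (simp add: uS)
  have orthA: "(W *\<^sub>v v i) \<bullet> (A *\<^sub>v x) = 0" if "i < m" for i
    unfolding Ax using orth[OF that] Bx u[of "Suc i"] that by (simp add: uS)
  have uB: "u i \<bullet> (B *\<^sub>v u j) = (if i = j then 1 else 0)" if ij: "i < Suc m" "j < Suc m" for i j
  proof (cases i; cases j)
    fix i' assume "i = Suc i'" "j = 0"
    then show ?thesis using orth[of i'] ij by (simp add: u0 uS)
  next
    fix j' assume "i = 0" "j = Suc j'"
    then show ?thesis using orth[of j'] ij sym_bilinear[OF B(1,2) x u[of j]] by (simp add: u0 uS)
  next
    fix i' j' assume "i = Suc i'" "j = Suc j'"
    then show ?thesis using vB[of i' j'] ij cg_form[OF B(1) v[of i'] v[of j']] by (simp add: uS)
  qed (simp add: u0 xBx)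
  have uA: "u i \<bullet> (A *\<^sub>v u j) = (if i = j then e j else 0)" if ij: "i < Suc m" "j < Suc m" for i j
  proof (cases i; cases j)
    assume "i = 0" "j = 0"
    then show ?thesis using xBx x Bx by (simp add: u0 Ax e_def)
  next
    fix i' assume "i = Suc i'" "j = 0"
    then show ?thesis using orthA[of i'] ij by (simp add: u0 uS)
  next
    fix j' assume "i = 0" "j = Suc j'"
    then show ?thesis using orthA[of j'] ij sym_bilinear[OF A x u[of j]] by (simp add: u0 uS)
  next
    fix i' j' assume "i = Suc i'" "j = Suc j'"
    then show ?thesis using vA[of i' j'] ij cg_form[OF A(1) v[of i'] v[of j']]
      by (simp add: uS e_def)
  qed
  show ?case using u uB uA by blast
qed

lemma simultaneous_diagonalization:
  fixes A B :: "real mat"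
  assumes A: "A \<in> carrier_mat n n" "A = transpose_mat A"
    and B: "B \<in> carrier_mat n n" "B = transpose_mat B" "pos_def B"
  obtains X d where "X \<in> carrier_mat n n" "transpose_mat X * (B * X) = 1\<^sub>m n"
    "transpose_mat X * (A * X) = mat_diag n d"
proof -
  obtain v d where v: "\<And>i. i < n \<Longrightarrow> v i \<in> carrier_vec n"
    and vB: "\<And>i j. i < n \<Longrightarrow> j < n \<Longrightarrow> v i \<bullet> (B *\<^sub>v v j) = (if i = j then 1 else 0)"
    and vA: "\<And>i j. i < n \<Longrightarrow> j < n \<Longrightarrow> v i \<bullet> (A *\<^sub>v v j) = (if i = j then d j else 0)"
    using exists_orthonormal_gen_eigenvectors[OF assms] by blast
  define X where "X = mat n n (\<lambda>(i, j). v j $ i)"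
  have X: "X \<in> carrier_mat n n" by (simp add: X_def)
  have colX: "col X i = v i" if "i < n" for i
    using v[OF that] that by (intro eq_vecI) (auto simp: X_def)
  have entry: "(transpose_mat X * (M * X)) $$ (i, j) = v i \<bullet> (M *\<^sub>v v j)"
    if "i < n" "j < n" "M \<in> carrier_mat n n" for M i j
    using that X by (simp add: colX col_mult2[of M n n X n] mult_mat_vec_def)
  have "transpose_mat X * (B * X) = 1\<^sub>m n"
    using X B(1) by (intro eq_matI) (simp_all add: entry vB del: index_mult_mat(1))
  moreover have "transpose_mat X * (A * X) = mat_diag n d"
    using X A(1) by (intro eq_matI) (simp_all add: entry vA mat_diag_def del: index_mult_mat(1))
  ultimately show ?thesis using that X by blast
qed

section \<open>Eigenvalues of a pencil as a function of its second matrix\<close>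

lemma poly_pencil_poly:
  assumes "A \<in> carrier_mat n n" "B \<in> carrier_mat n n"
  shows "poly (pencil_poly A B) x = det (x \<cdot>\<^sub>m B - A)"
  unfolding pencil_poly_def by (rule poly_det_cong[of _ n]) (use assms in auto)

lemma det_mat_diag: "det (mat_diag n f) = prod_list (map f [0..<n])"
proof -
  have "det (mat_diag n f) = prod_list (diag_mat (mat_diag n f))"
    by (intro det_upper_triangular[of _ n]) (auto simp: mat_diag_def)
  also have "diag_mat (mat_diag n f) = map f [0..<n]"
    by (auto simp: diag_mat_def mat_diag_def)
  finally show ?thesis .
qed

text \<open>This links the root multiplicities in \<^const>\<open>gen_eigenvalue_list\<close> to eigenvectors: the congruence by \<open>X\<close>
multiplies the pencil polynomial by the nonzero constant \<open>(det X)\<^sup>2\<close> and turns it into the product of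
the factors \<open>x - d i\<close>.\<close>

lemma gen_eigenvalue_list_diagonalized:
  fixes A B X :: "real mat"
  assumes A: "A \<in> carrier_mat n n" and B: "B \<in> carrier_mat n n" and X: "X \<in> carrier_mat n n"
    and XB: "transpose_mat X * (B * X) = 1\<^sub>m n"
    and XA: "transpose_mat X * (A * X) = mat_diag n d"
  shows "gen_eigenvalue_list A B = sort (map d [0..<n])"
proof -
  have Xt: "transpose_mat X \<in> carrier_mat n n" using X by simp
  let ?p = "prod_list (map (\<lambda>i. [:- d i, 1:]) [0..<n])"
  have "det (transpose_mat X * (B * X)) = 1" unfolding XB by simp
  then have detX: "det X \<noteq> 0"
    using det_mult[OF Xt, of "B * X"] det_mult[OF B X] B X by auto
  have "poly (Polynomial.smult (det X * det X) (pencil_poly A B)) x = poly ?p x" for x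
  proof -
    have M: "x \<cdot>\<^sub>m B - A \<in> carrier_mat n n" using A B by auto
    have "transpose_mat X * ((x \<cdot>\<^sub>m B - A) * X) = x \<cdot>\<^sub>m 1\<^sub>m n - mat_diag n d"
    proof -
      have "(x \<cdot>\<^sub>m B - A) * X = x \<cdot>\<^sub>m (B * X) - A * X"
        using A B X by (simp add: minus_mult_distrib_mat[of _ n n] mult_smult_assoc_mat[of _ n n _ n])
      moreover have "transpose_mat X * (x \<cdot>\<^sub>m (B * X) - A * X)
          = x \<cdot>\<^sub>m (transpose_mat X * (B * X)) - transpose_mat X * (A * X)"
        using A B X Xt by (simp add: mult_minus_distrib_mat[of _ n n _ n] mult_smult_distrib[of _ n n _ n])
      ultimately show ?thesis unfolding XB XA by simp
    qed
    also have "\<dots> = mat_diag n (\<lambda>i. x - d i)"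
      by (rule eq_matI) (auto simp: mat_diag_def)
    finally have "det X * (det (x \<cdot>\<^sub>m B - A) * det X) = prod_list (map (\<lambda>i. x - d i) [0..<n])"
      using det_mult[OF Xt, of "(x \<cdot>\<^sub>m B - A) * X"] det_mult[OF M X] M X
      by (simp add: det_mat_diag det_transpose)
    moreover have "poly ?p x = prod_list (map (\<lambda>i. x - d i) [0..<n])"
      by (simp add: poly_prod_list o_def)
    ultimately show ?thesis using poly_pencil_poly[OF A B] by (simp add: ac_simps)
  qed
  then have "Polynomial.smult (det X * det X) (pencil_poly A B) = ?p"
    by (simp add: poly_eq_poly_eq_iff[symmetric] fun_eq_iff)
  then have "proots (pencil_poly A B) = proots ?p"
    using detX proots_smult[of "det X * det X" "pencil_poly A B"] by simp
  also have "proots (prod_list (map (\<lambda>i. [:- d i, 1:]) is)) = mset (map d is)" for "is"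
  proof (induction "is")
    case (Cons i "is")
    have "prod_list (map (\<lambda>i. [:- d i, 1:]) is) \<noteq> 0" by (auto simp: prod_list_zero_iff)
    then show ?case using Cons.IH by (simp add: proots_mult del: mult_pCons_left)
  qed simp
  finally show ?thesis
    unfolding gen_eigenvalue_list_def by (simp only: sorted_list_of_multiset_mset)
qed

text \<open>Each \<open>x\<close> is the combination of the columns of \<open>X\<close> with coefficients \<open>(B *\<^sub>v col X i) \<bullet> x\<close>, because
\<open>transpose_mat X * B\<close> is the inverse of \<open>X\<close>. In these coordinates both forms are sums of squares.\<close>

lemma diagonalized_coordinates:
  fixes A B X :: "real mat"
  assumes A: "A \<in> carrier_mat n n" and B: "B \<in> carrier_mat n n" "B = transpose_mat B"
    and X: "X \<in> carrier_mat n n"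
    and XB: "transpose_mat X * (B * X) = 1\<^sub>m n"
    and XA: "transpose_mat X * (A * X) = mat_diag n d"
    and x: "x \<in> carrier_vec n"
  shows "x \<bullet> (B *\<^sub>v x) = (\<Sum>i<n. ((B *\<^sub>v col X i) \<bullet> x)\<^sup>2)"
    and "x \<bullet> (A *\<^sub>v x) = (\<Sum>i<n. d i * ((B *\<^sub>v col X i) \<bullet> x)\<^sup>2)"
proof -
  have Xt: "transpose_mat X \<in> carrier_mat n n" using X by simp
  define u where "u = transpose_mat X *\<^sub>v (B *\<^sub>v x)"
  have u: "u \<in> carrier_vec n" unfolding u_def using X B x by simp
  have ui: "u $ i = (B *\<^sub>v col X i) \<bullet> x" if i: "i < n" for i
  proof -
    have c: "col X i \<in> carrier_vec n" using X by auto
    have Bc: "B *\<^sub>v col X i \<in> carrier_vec n" using B c by auto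
    have "u $ i = col X i \<bullet> (B *\<^sub>v x)" unfolding u_def using X i by simp
    also have "\<dots> = x \<bullet> (B *\<^sub>v col X i)" by (rule sym_bilinear[OF B c x])
    finally show ?thesis using comm_scalar_prod[OF x Bc] by simp
  qed
  \<comment> \<open>A left inverse of a square matrix is a right inverse, which makes u the coordinate vector of x.\<close>
  have "(transpose_mat X * B) * X = 1\<^sub>m n"
    using XB assoc_mult_mat[OF Xt B(1) X] by simp
  then have "X * (transpose_mat X * B) = 1\<^sub>m n"
    using mat_mult_left_right_inverse[of "transpose_mat X * B" n X] X B by auto
  moreover have "X *\<^sub>v u = (X * (transpose_mat X * B)) *\<^sub>v x"
    unfolding u_def using X Xt B(1) x
    by (simp add: assoc_mult_mat_vec[of _ n n _ n])
  ultimately have xu: "x = X *\<^sub>v u" using x by simp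
  have form: "x \<bullet> (M *\<^sub>v x) = u \<bullet> ((transpose_mat X * (M * X)) *\<^sub>v u)"
    if M: "M \<in> carrier_mat n n" for M
  proof -
    have y: "M *\<^sub>v x \<in> carrier_vec n" "transpose_mat X *\<^sub>v (M *\<^sub>v x) \<in> carrier_vec n"
      using M X x by auto
    have "(transpose_mat X * (M * X)) *\<^sub>v u = transpose_mat X *\<^sub>v (M *\<^sub>v x)"
      using M X u by (simp add: assoc_mult_mat_vec[of _ n n _ n] xu)
    then show ?thesis
      using transpose_vec_mult_scalar[OF X u y(1)] comm_scalar_prod[OF u y(2)]
        comm_scalar_prod[OF x y(1)] xu by simp
  qed
  have diag: "u \<bullet> (mat_diag n f *\<^sub>v u) = (\<Sum>i<n. f i * (u $ i)\<^sup>2)" for f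
  proof -
    have "(mat_diag n f *\<^sub>v u) $ i = f i * u $ i" if "i < n" for i
    proof -
      have "(mat_diag n f *\<^sub>v u) $ i = (\<Sum>j<n. mat_diag n f $$ (i, j) * u $ j)"
        using that u by (simp add: scalar_prod_def atLeast0LessThan mat_diag_def)
      also have "\<dots> = (\<Sum>j<n. if i = j then f j * u $ j else 0)"
        using that by (intro sum.cong) (auto simp: mat_diag_def)
      finally show ?thesis using that by simp
    qed
    moreover have "dim_vec (mat_diag n f *\<^sub>v u) = n" by (simp add: mat_diag_def)
    ultimately show ?thesis
      by (auto simp: scalar_prod_def atLeast0LessThan power2_eq_square ac_simps intro!: sum.cong)
  qed
  have "u \<bullet> (1\<^sub>m n *\<^sub>v u) = (\<Sum>i<n. (u $ i)\<^sup>2)"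
    using diag[of "\<lambda>_. 1"] by simp
  then show "x \<bullet> (B *\<^sub>v x) = (\<Sum>i<n. ((B *\<^sub>v col X i) \<bullet> x)\<^sup>2)"
    using form[OF B(1)] ui unfolding XB by simp
  show "x \<bullet> (A *\<^sub>v x) = (\<Sum>i<n. d i * ((B *\<^sub>v col X i) \<bullet> x)\<^sup>2)"
    using form[OF A] ui diag[of d] unfolding XA by simp
qed

text \<open>Fewer than \<open>n\<close> linear conditions have a common nonzero solution: padding them with zero rows gives a
square matrix whose transpose annihilates the last unit vector, hence a singular one.\<close>

lemma exists_common_orthogonal_vec:
  fixes ws :: "'a :: field vec list"
  assumes ws: "set ws \<subseteq> carrier_vec n" "length ws < n"
  obtains x where "x \<in> carrier_vec n" "x \<noteq> 0\<^sub>v n" "\<And>w. w \<in> set ws \<Longrightarrow> w \<bullet> x = 0"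
proof -
  define vs where "vs = ws @ replicate (n - length ws) (0\<^sub>v n)"
  have vs: "length vs = n" "set vs \<subseteq> carrier_vec n" "vs ! (n - 1) = 0\<^sub>v n"
    using ws by (auto simp: vs_def nth_append)
  define M where "M = mat_of_rows n vs"
  have M: "M \<in> carrier_mat n n" unfolding M_def using vs by auto
  have "transpose_mat M *\<^sub>v unit_vec n (n - 1) = 0\<^sub>v n"
  proof (rule eq_vecI)
    fix i assume i: "i < dim_vec (0\<^sub>v n :: 'a vec)"
    have "(transpose_mat M *\<^sub>v unit_vec n (n - 1)) $ i = M $$ (n - 1, i)"
      using M i ws(2) by simp
    also have "\<dots> = 0" unfolding M_def using vs i by (simp add: mat_of_rows_index)
    finally show "(transpose_mat M *\<^sub>v unit_vec n (n - 1)) $ i = 0\<^sub>v n $ i" using i by simp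
  qed (use M in auto)
  moreover have "unit_vec n (n - 1) \<noteq> (0\<^sub>v n :: 'a vec)"
    using ws(2) by simp
  ultimately have "\<exists>v. v \<in> carrier_vec n \<and> v \<noteq> 0\<^sub>v n \<and> transpose_mat M *\<^sub>v v = 0\<^sub>v n"
    by (intro exI[of _ "unit_vec n (n - 1)"]) simp
  then have "det (transpose_mat M) = 0"
    using det_0_iff_vec_prod_zero_field[of "transpose_mat M" n] M by simp
  then have "det M = 0" using det_transpose[OF M] by simp
  then obtain x where x: "x \<in> carrier_vec n" "x \<noteq> 0\<^sub>v n" "M *\<^sub>v x = 0\<^sub>v n"
    using det_0_iff_vec_prod_zero_field[OF M] by auto
  have "w \<bullet> x = 0" if "w \<in> set ws" for w
  proof -
    have "w \<in> set vs" using that by (simp add: vs_def)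
    then obtain i where i: "i < n" "w = vs ! i" using vs by (auto simp: in_set_conv_nth)
    have "row M i = w" unfolding M_def using i vs nth_mem[of i vs] by (simp add: subset_iff)
    then show ?thesis using arg_cong[OF x(3), of "\<lambda>v. v $ i"] M i by simp
  qed
  then show ?thesis using that x by blast
qed

lemma sorted_count_less_nth:
  assumes "sorted xs" "k < length xs"
  shows "length (filter (\<lambda>z. z < xs ! k) xs) \<le> k"
proof -
  have "{i. i < length xs \<and> xs ! i < xs ! k} \<subseteq> {..<k}"
    using assms by (force simp: not_less[symmetric] dest: sorted_nth_mono[of xs k])
  then have "card {i. i < length xs \<and> xs ! i < xs ! k} \<le> card {..<k}"
    by (intro card_mono) auto
  then show ?thesis by (simp add: length_filter_conv_card)
qed

lemma sorted_count_greater_nth: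
  assumes "sorted xs" "k < length xs"
  shows "length (filter (\<lambda>z. xs ! k < z) xs) < length xs - k"
proof -
  have "{i. i < length xs \<and> xs ! k < xs ! i} \<subseteq> {k<..<length xs}"
    using assms sorted_nth_mono[of xs _ k] by (force simp: not_less[symmetric])
  then have "card {i. i < length xs \<and> xs ! k < xs ! i} \<le> card {k<..<length xs}"
    by (intro card_mono) auto
  then show ?thesis using assms by (simp add: length_filter_conv_card)
qed

lemma length_filter_sort_map:
  "length (filter p (sort (map f xs))) = length (filter (\<lambda>i. p (f i)) xs)"
  by (simp add: filter_sort filter_map o_def)

text \<open>The comparison behind the Courant-Fischer principle, by a dimension count. If the \<open>k\<close>-th eigenvalue \<open>b\<close> of
\<open>(A, Q)\<close> were smaller than the \<open>k\<close>-th eigenvalue \<open>a\<close> of \<open>(A, P)\<close>, the span of the \<open>P\<close>-eigenvectors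
with eigenvalue at least \<open>a\<close> would have dimension greater than \<open>n - k\<close>, and the span of the \<open>Q\<close>-eigenvectors
with eigenvalue at most \<open>b\<close> dimension at least \<open>k\<close>. A common nonzero vector \<open>x\<close> would satisfy
\<open>a * (x \<bullet> (P *\<^sub>v x)) \<le> x \<bullet> (A *\<^sub>v x) \<le> b * (x \<bullet> (Q *\<^sub>v x)) < a * (x \<bullet> (Q *\<^sub>v x))\<close>, which
contradicts \<open>Q \<le> P\<close> because \<open>a \<ge> 0\<close>.\<close>

lemma gen_eigenvalue_antimono:
  fixes A P Q :: "real mat"
  assumes A: "A \<in> carrier_mat n n" "A = transpose_mat A" "pos_semidef A"
    and P: "P \<in> carrier_mat n n" "P = transpose_mat P" "pos_def P"
    and Q: "Q \<in> carrier_mat n n" "Q = transpose_mat Q" "pos_def Q"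
    and le: "\<And>x. x \<in> carrier_vec n \<Longrightarrow> x \<bullet> (Q *\<^sub>v x) \<le> x \<bullet> (P *\<^sub>v x)"
    and k: "k \<in> {1..n}"
  shows "gen_eigenvalue k A P \<le> gen_eigenvalue k A Q"
proof (rule ccontr)
  obtain X d where X: "X \<in> carrier_mat n n" "transpose_mat X * (P * X) = 1\<^sub>m n"
    "transpose_mat X * (A * X) = mat_diag n d"
    using simultaneous_diagonalization[OF A(1,2) P] by blast
  obtain Y e where Y: "Y \<in> carrier_mat n n" "transpose_mat Y * (Q * Y) = 1\<^sub>m n"
    "transpose_mat Y * (A * Y) = mat_diag n e"
    using simultaneous_diagonalization[OF A(1,2) Q] by blast
  note cX = diagonalized_coordinates[OF A(1) P(1,2) X]
  note cY = diagonalized_coordinates[OF A(1) Q(1,2) Y]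
  let ?D = "sort (map d [0..<n])" and ?E = "sort (map e [0..<n])"
  define a where "a = ?D ! (k - 1)"
  define b where "b = ?E ! (k - 1)"
  assume "\<not> gen_eigenvalue k A P \<le> gen_eigenvalue k A Q"
  then have ba: "b < a"
    unfolding gen_eigenvalue_def a_def b_def
      gen_eigenvalue_list_diagonalized[OF A(1) P(1) X]
      gen_eigenvalue_list_diagonalized[OF A(1) Q(1) Y] by simp
  have "0 \<le> a"
  proof -
    have "a \<in> set ?D" unfolding a_def using k by (intro nth_mem) auto
    then obtain i where i: "i < n" "a = d i" by auto
    have c: "col X i \<in> carrier_vec n" using X by auto
    have "d i = (transpose_mat X * (A * X)) $$ (i, i)" unfolding X(3) using i by (simp add: mat_diag_def)
    also have "\<dots> = col X i \<bullet> (A *\<^sub>v col X i)"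
      using X(1) A(1) i by (simp add: col_mult2[of A n n X n] mult_mat_vec_def)
    finally show ?thesis using A(1,3) c i unfolding pos_semidef_def by auto
  qed
  let ?I = "filter (\<lambda>i. d i < a) [0..<n]" and ?J = "filter (\<lambda>i. b < e i) [0..<n]"
  have k1: "k - 1 < n" using k by auto
  have "length ?I \<le> k - 1"
    using sorted_count_less_nth[of ?D "k - 1"] k1
    unfolding length_filter_sort_map a_def by simp
  moreover have "length ?J < n - (k - 1)"
    using sorted_count_greater_nth[of ?E "k - 1"] k1
    unfolding length_filter_sort_map b_def by simp
  ultimately have len: "length ?I + length ?J < n" by linarith
  \<comment> \<open>Membership in the two spans, as the vanishing of the remaining coordinates.\<close>
  define ws where "ws = map (\<lambda>i. P *\<^sub>v col X i) ?I @ map (\<lambda>i. Q *\<^sub>v col Y i) ?J"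
  have "set ws \<subseteq> carrier_vec n" "length ws < n"
    unfolding ws_def using P(1) Q(1) X(1) Y(1) len by auto
  then obtain x where x: "x \<in> carrier_vec n" "x \<noteq> 0\<^sub>v n" "\<And>w. w \<in> set ws \<Longrightarrow> w \<bullet> x = 0"
    using exists_common_orthogonal_vec by blast
  have "a * (x \<bullet> (P *\<^sub>v x)) \<le> x \<bullet> (A *\<^sub>v x)"
    unfolding cX[OF x(1)] sum_distrib_left
  proof (rule sum_mono)
    fix i assume "i \<in> {..<n}"
    then have "d i < a \<Longrightarrow> (P *\<^sub>v col X i) \<bullet> x = 0" by (intro x(3)) (auto simp: ws_def)
    then show "a * ((P *\<^sub>v col X i) \<bullet> x)\<^sup>2 \<le> d i * ((P *\<^sub>v col X i) \<bullet> x)\<^sup>2"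
      by (cases "d i < a") (auto intro!: mult_right_mono)
  qed
  moreover have "x \<bullet> (A *\<^sub>v x) \<le> b * (x \<bullet> (Q *\<^sub>v x))"
    unfolding cY[OF x(1)] sum_distrib_left
  proof (rule sum_mono)
    fix i assume "i \<in> {..<n}"
    then have "b < e i \<Longrightarrow> (Q *\<^sub>v col Y i) \<bullet> x = 0" by (intro x(3)) (auto simp: ws_def)
    then show "e i * ((Q *\<^sub>v col Y i) \<bullet> x)\<^sup>2 \<le> b * ((Q *\<^sub>v col Y i) \<bullet> x)\<^sup>2"
      by (cases "b < e i") (auto intro!: mult_right_mono)
  qed
  moreover have "a * (x \<bullet> (Q *\<^sub>v x)) \<le> a * (x \<bullet> (P *\<^sub>v x))"
    using le[OF x(1)] \<open>0 \<le> a\<close> by (rule mult_left_mono)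
  moreover have "b * (x \<bullet> (Q *\<^sub>v x)) < a * (x \<bullet> (Q *\<^sub>v x))"
    using ba Q x unfolding pos_def_def by auto
  ultimately show False by linarith
qed

lemma length_gen_eigenvalue_list:
  assumes "A \<in> carrier_mat n n" "A = transpose_mat A"
    and "B \<in> carrier_mat n n" "B = transpose_mat B" "pos_def B"
  shows "length (gen_eigenvalue_list A B) = n"
  using simultaneous_diagonalization[OF assms] gen_eigenvalue_list_diagonalized[OF assms(1,3)]
  by (metis diff_zero length_map length_sort length_upt)

text \<open>The list is sorted and its entries are exactly the generalized eigenvalues; since it has length \<open>n\<close>, its
last entry is their maximum.\<close>

lemma gen_eigenvalue_last_eq_Max:
  assumes A: "A \<in> carrier_mat n n" "A = transpose_mat A"
    and B: "B \<in> carrier_mat n n" "B = transpose_mat B" "pos_def B" and n: "n > 0"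
    and c: "c \<in> gen_eigenvalues A B" "\<And>c'. c' \<in> gen_eigenvalues A B \<Longrightarrow> c' \<le> c"
  shows "gen_eigenvalue n A B = c"
proof -
  let ?l = "gen_eigenvalue_list A B"
  have len: "length ?l = n" by (rule length_gen_eigenvalue_list[OF A B])
  then have "pencil_poly A B \<noteq> 0" using n by (auto simp: gen_eigenvalue_list_def)
  then have set: "set ?l = gen_eigenvalues A B"
    unfolding gen_eigenvalues_eq_roots[OF A(1) B(1)] gen_eigenvalue_list_def by simp
  have "?l ! (n - 1) \<in> set ?l" using len n by (intro nth_mem) auto
  moreover from c(1) obtain i where i: "i < n" "?l ! i = c"
    unfolding set[symmetric] using len by (auto simp: in_set_conv_nth)
  then have "c \<le> ?l ! (n - 1)"
    using sorted_nth_mono[of ?l i "n - 1"] len by (auto simp: gen_eigenvalue_list_def)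
  ultimately show ?thesis using c(2) set unfolding gen_eigenvalue_def by (simp add: order_antisym)
qed

section \<open>Entries and quadratic form of block lumped matrices\<close>

lemma block_index_less:
  fixes k m p r :: nat
  assumes "k < m" "p < r"
  shows "k * r + p < m * r"
proof -
  have "k * r + p < Suc k * r" using assms by simp
  also have "\<dots> \<le> m * r" using assms by (intro mult_right_mono) auto
  finally show ?thesis .
qed

lemma sum_over_blocks:
  "(\<Sum>i<m * r. f i) = (\<Sum>k<m. \<Sum>p<r. f (k * r + p))" for f :: "nat \<Rightarrow> 'a :: comm_monoid_add"
proof -
  have "sum f {k * r..<k * r + r} = (\<Sum>p<r. f (k * r + p))" for k
    using sum.shift_bounds_nat_ivl[of f 0 "k * r" r] by (simp add: atLeast0LessThan add.commute)
  then show ?thesis by (simp add: sum.nat_group[symmetric])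
qed

text \<open>Indices are written as \<open>k * r + p\<close>, i.e. as entry \<open>p\<close> of block \<open>k\<close>; this form is kept below, so that
block arguments need no division.\<close>

lemma diag_block_mat_index:
  assumes "\<And>A. A \<in> set As \<Longrightarrow> A \<in> carrier_mat r r"
    and "k < length As" "l < length As" "p < r" "q < r"
  shows "diag_block_mat As $$ (k * r + p, l * r + q) = (if k = l then As ! k $$ (p, q) else 0)"
  using assms
proof (induction As arbitrary: k l)
  case (Cons A As)
  let ?D = "diag_block_mat As"
  have A: "dim_row A = r" "dim_col A = r" using Cons.prems(1)[of A] by auto
  have dims: "map dim_row As = map (\<lambda>_. r) As" "map dim_col As = map (\<lambda>_. r) As"
    using Cons.prems(1) by auto
  have D: "dim_row ?D = length As * r" "dim_col ?D = length As * r"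
    unfolding dim_diag_block_mat dims by (simp_all add: sum_list_triv)
  have "k * r + p < Suc (length As) * r" "l * r + q < Suc (length As) * r"
    using Cons.prems by (auto intro: block_index_less simp del: mult_Suc)
  then have idx: "k * r + p < dim_row A + dim_row ?D" "l * r + q < dim_col A + dim_col ?D"
    using A D by auto
  show ?case
  proof (cases k; cases l)
    fix k' l' assume "k = Suc k'" "l = Suc l'"
    then show ?thesis
      using Cons.IH[of k' l'] Cons.prems idx A by (simp add: Let_def)
  next
    fix k' assume *: "k = Suc k'" "l = 0"
    then have "k' * r + p < length As * r" using Cons.prems by (auto intro: block_index_less)
    then show ?thesis using * Cons.prems idx A D by (simp add: Let_def)
  next
    fix l' assume *: "k = 0" "l = Suc l'"
    then have "l' * r + q < length As * r" using Cons.prems by (auto intro: block_index_less)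
    then show ?thesis using * Cons.prems idx A D by (simp add: Let_def)
  qed (use Cons.prems idx A in \<open>simp add: Let_def\<close>)
qed simp

lemma block_lumped_carrier: "block_lumped m r B i \<in> carrier_mat (m * r) (m * r)"
proof -
  have "sum_list (map dim_row (map (\<lambda>i. mat r r (f i)) [0..<m])) = m * r"
    and "sum_list (map dim_col (map (\<lambda>i. mat r r (f i)) [0..<m])) = m * r"
    for f :: "nat \<Rightarrow> nat \<times> nat \<Rightarrow> real"
    by (simp_all add: o_def sum_list_triv)
  then show ?thesis
    unfolding block_lumped_def block_lump_def
    by (intro carrier_matI) (simp_all add: dim_diag_block_mat)
qed

text \<open>Near blocks, those with \<open>\<bar>k - l\<bar> < i\<close>, stay in place; each far block is moved onto the diagonal block of its
block row.\<close>

lemma block_lumped_index: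
  assumes B: "B \<in> carrier_mat (m * r) (m * r)" and "k < m" "l < m" "p < r" "q < r"
  shows "block_lumped m r B i $$ (k * r + p, l * r + q) =
    (if \<bar>int k - int l\<bar> < int i then B $$ (k * r + p, l * r + q) else 0) +
    (if k = l then \<Sum>j<m. if \<bar>int k - int j\<bar> < int i then 0 else B $$ (k * r + p, j * r + q) else 0)"
proof -
  let ?C = "B - block_band m r B i"
  have dv: "(k * r + p) div r = k" "(l * r + q) div r = l" "(j * r + q) div r = j" for j
    using assms by auto
  have less: "j * r + p < m * r" "j * r + q < m * r" if "j < m" for j
    using that assms by (auto intro: block_index_less)
  have band: "block_band m r B i $$ (k * r + p, j * r + q) =
      (if \<bar>int k - int j\<bar> < int i then B $$ (k * r + p, j * r + q) else 0)" if "j < m" for j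
    using that assms less dv by (simp add: block_band_def)
  have "block_lump m r ?C $$ (k * r + p, l * r + q) =
      (if k = l then \<Sum>j<m. block r ?C k j $$ (p, q) else 0)"
    unfolding block_lump_def using assms by (subst diag_block_mat_index[of _ r]) auto
  also have "(\<Sum>j<m. block r ?C k j $$ (p, q)) =
      (\<Sum>j<m. if \<bar>int k - int j\<bar> < int i then 0 else B $$ (k * r + p, j * r + q))"
  proof (rule sum.cong)
    fix j assume "j \<in> {..<m}"
    then have j: "j < m" by simp
    have bc: "block_band m r B i \<in> carrier_mat (m * r) (m * r)" by (simp add: block_band_def)
    show "block r ?C k j $$ (p, q) =
        (if \<bar>int k - int j\<bar> < int i then 0 else B $$ (k * r + p, j * r + q))"
      using assms j less band[OF j] bc by (simp add: block_def)
  qed simp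
  finally have lump: "block_lump m r ?C $$ (k * r + p, l * r + q) =
      (if k = l then \<Sum>j<m. if \<bar>int k - int j\<bar> < int i then 0 else B $$ (k * r + p, j * r + q) else 0)" .
  have "block_lumped m r B i \<in> carrier_mat (m * r) (m * r)" by (rule block_lumped_carrier)
  then have "dim_row (block_lump m r ?C) = m * r" "dim_col (block_lump m r ?C) = m * r"
    by (auto simp: block_lumped_def)
  then show ?thesis
    unfolding block_lumped_def using less assms band[of l] lump by simp
qed

lemma quad_form_blocks:
  assumes "M \<in> carrier_mat (m * r) (m * r)" "x \<in> carrier_vec (m * r)"
  shows "x \<bullet> (M *\<^sub>v x) =
    (\<Sum>k<m. \<Sum>l<m. \<Sum>p<r. \<Sum>q<r. x $ (k * r + p) * M $$ (k * r + p, l * r + q) * x $ (l * r + q))"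
proof -
  have "x \<bullet> (M *\<^sub>v x) = (\<Sum>i<m * r. \<Sum>j<m * r. x $ i * M $$ (i, j) * x $ j)"
    using assms by (auto simp: scalar_prod_def atLeast0LessThan sum_distrib_left mult.assoc intro!: sum.cong)
  also have "\<dots> = (\<Sum>k<m. \<Sum>p<r. \<Sum>l<m. \<Sum>q<r.
      x $ (k * r + p) * M $$ (k * r + p, l * r + q) * x $ (l * r + q))"
    by (simp add: sum_over_blocks)
  also have "\<dots> = (\<Sum>k<m. \<Sum>l<m. \<Sum>p<r. \<Sum>q<r.
      x $ (k * r + p) * M $$ (k * r + p, l * r + q) * x $ (l * r + q))"
    by (intro sum.cong refl sum.swap)
  finally show ?thesis .
qed

text \<open>Combining the symmetry of \<open>B\<close> with that of its blocks gives invariance under exchanging the block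
indices alone.\<close>

lemma block_sym_entries:
  fixes B :: "real mat"
  assumes B: "B \<in> carrier_mat (m * r) (m * r)" "B = transpose_mat B"
    and blocks: "block r B k l \<in> sym_psd r"
    and "k < m" "l < m" "p < r" "q < r"
  shows "B $$ (k * r + p, l * r + q) = B $$ (k * r + q, l * r + p)"
    and "B $$ (k * r + p, l * r + q) = B $$ (l * r + p, k * r + q)"
proof -
  have less: "k * r + p < m * r" "l * r + p < m * r" "k * r + q < m * r" "l * r + q < m * r"
    using assms by (auto intro: block_index_less)
  have "block r B k l $$ (p, q) = block r B k l $$ (q, p)"
    using blocks assms(6,7) index_transpose_mat(1)[of p "block r B k l" q]
    unfolding sym_psd_def by (auto simp: block_def)
  then show 1: "B $$ (k * r + p, l * r + q) = B $$ (k * r + q, l * r + p)"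
    using assms by (simp add: block_def)
  have "B $$ (k * r + q, l * r + p) = B $$ (l * r + p, k * r + q)"
    using B index_transpose_mat(1)[of "k * r + q" B "l * r + p"] less by auto
  with 1 show "B $$ (k * r + p, l * r + q) = B $$ (l * r + p, k * r + q)" by simp
qed

text \<open>What lumping adds to a diagonal block is a sum of blocks of one block row, which is symmetric because each
of them is.\<close>

lemma block_lumped_sym:
  fixes B :: "real mat"
  assumes B: "B \<in> carrier_mat (m * r) (m * r)" "B = transpose_mat B"
    and blocks: "\<And>k l. k < m \<Longrightarrow> l < m \<Longrightarrow> block r B k l \<in> sym_psd r"
  shows "block_lumped m r B i = transpose_mat (block_lumped m r B i)" (is "?P = _")
proof (rule eq_matI)
  have P: "?P \<in> carrier_mat (m * r) (m * r)" by (rule block_lumped_carrier)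
  fix a b assume "a < dim_row (transpose_mat ?P)" "b < dim_col (transpose_mat ?P)"
  then have ab: "a < m * r" "b < m * r" using P by auto
  then have r: "r > 0" by (cases r) auto
  define k l p q where "k = a div r" and "l = b div r" and "p = a mod r" and "q = b mod r"
  have a: "a = k * r + p" and b: "b = l * r + q" by (auto simp: k_def l_def p_def q_def)
  have less: "k < m" "l < m" "p < r" "q < r"
    using ab r by (auto simp: k_def l_def p_def q_def less_mult_imp_div_less)
  have near: "B $$ (l * r + q, k * r + p) = B $$ (k * r + p, l * r + q)"
    using B index_transpose_mat(1)[of "l * r + q" B "k * r + p"] ab unfolding a b by auto
  have far: "(\<Sum>j<m. if \<bar>int k - int j\<bar> < int i then 0 else B $$ (k * r + q, j * r + p)) =
      (\<Sum>j<m. if \<bar>int k - int j\<bar> < int i then 0 else B $$ (k * r + p, j * r + q))"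
  proof (rule sum.cong)
    fix j assume "j \<in> {..<m}"
    then have j: "j < m" by simp
    show "(if \<bar>int k - int j\<bar> < int i then 0 else B $$ (k * r + q, j * r + p)) =
        (if \<bar>int k - int j\<bar> < int i then 0 else B $$ (k * r + p, j * r + q))"
      using block_sym_entries(1)[OF B blocks[OF less(1) j] less(1) j less(3,4)] by simp
  qed simp
  have "?P $$ (b, a) = ?P $$ (a, b)"
    unfolding a b block_lumped_index[OF B(1) less] block_lumped_index[OF B(1) less(2,1,4,3)] near
    using far by (cases "k = l") (simp_all add: abs_minus_commute cong: if_cong)
  then show "?P $$ (a, b) = transpose_mat ?P $$ (a, b)" using ab P by simp
qed (use block_lumped_carrier[of m r B i] in auto)

text \<open>Moving blocks within a block row does not change the action on a vector all of whose blocks agree. For the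
all-ones vector this makes 1 a generalized eigenvalue.\<close>

lemma block_lumped_row_sums:
  assumes B: "B \<in> carrier_mat (m * r) (m * r)"
  shows "block_lumped m r B i *\<^sub>v vec (m * r) (\<lambda>_. 1) = B *\<^sub>v vec (m * r) (\<lambda>_. 1)"
proof (rule eq_vecI)
  let ?P = "block_lumped m r B i"
  have P: "?P \<in> carrier_mat (m * r) (m * r)" by (rule block_lumped_carrier)
  fix a assume "a < dim_vec (B *\<^sub>v vec (m * r) (\<lambda>_. 1))"
  then have am: "a < m * r" using B by simp
  then have r: "r > 0" by (cases r) auto
  define k p where "k = a div r" and "p = a mod r"
  have a: "a = k * r + p" by (auto simp: k_def p_def)
  have less: "k < m" "p < r" using am r by (auto simp: k_def p_def less_mult_imp_div_less)
  have rs: "(M *\<^sub>v vec (m * r) (\<lambda>_. 1)) $ a = (\<Sum>l<m. \<Sum>q<r. M $$ (k * r + p, l * r + q))"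
    if "M \<in> carrier_mat (m * r) (m * r)" for M :: "real mat"
    using that am by (simp add: scalar_prod_def atLeast0LessThan sum_over_blocks a)
  let ?near = "\<lambda>j. \<bar>int k - int j\<bar> < int i"
  let ?b = "\<lambda>j q. B $$ (k * r + p, j * r + q)"
  have "(\<Sum>l<m. \<Sum>q<r. ?P $$ (k * r + p, l * r + q)) =
      (\<Sum>l<m. \<Sum>q<r. if ?near l then ?b l q else 0) +
      (\<Sum>l<m. if k = l then \<Sum>q<r. \<Sum>j<m. if ?near j then 0 else ?b j q else 0)"
    unfolding sum.distrib[symmetric] using less
    by (intro sum.cong) (auto simp: block_lumped_index[OF B] sum.distrib)
  also have "\<dots> = (\<Sum>l<m. \<Sum>q<r. if ?near l then ?b l q else 0) +
      (\<Sum>q<r. \<Sum>j<m. if ?near j then 0 else ?b j q)"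
    using less by simp
  also have "\<dots> = (\<Sum>l<m. \<Sum>q<r. ?b l q)"
    unfolding sum.swap[of _ "{..<m}" "{..<r}"] sum.distrib[symmetric]
    by (intro sum.cong) auto
  finally show "(?P *\<^sub>v vec (m * r) (\<lambda>_. 1)) $ a = (B *\<^sub>v vec (m * r) (\<lambda>_. 1)) $ a"
    using rs[OF P] rs[OF B] by simp
qed (use block_lumped_carrier[of m r B i] B in auto)

text \<open>The identity on which everything rests. Write \<open>F k l\<close> for the bilinear form of the block \<open>(k, l)\<close> and
\<open>X k\<close> for the \<open>k\<close>-th block of \<open>x\<close>. Lumping a far block replaces \<open>F k l (X k) (X l)\<close> by
\<open>F k l (X k) (X k)\<close>. As the blocks \<open>(k, l)\<close> and \<open>(l, k)\<close> coincide, adding the changes of both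
gives \<open>F k l\<close> at the difference \<open>X k - X l\<close>, and the sum over all far pairs counts each of them twice.\<close>

lemma block_lumped_quad_form:
  fixes B :: "real mat" and x :: "real vec"
  assumes B: "B \<in> carrier_mat (m * r) (m * r)" "B = transpose_mat B"
    and blocks: "\<And>k l. k < m \<Longrightarrow> l < m \<Longrightarrow> block r B k l \<in> sym_psd r"
    and x: "x \<in> carrier_vec (m * r)"
  defines "D \<equiv> \<lambda>k l. vec r (\<lambda>p. x $ (k * r + p) - x $ (l * r + p))"
  shows "x \<bullet> (block_lumped m r B i *\<^sub>v x) = x \<bullet> (B *\<^sub>v x) +
    (\<Sum>k<m. \<Sum>l<m. if \<bar>int k - int l\<bar> < int i then 0 else D k l \<bullet> (block r B k l *\<^sub>v D k l)) / 2"
proof -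
  let ?P = "block_lumped m r B i"
  let ?near = "\<lambda>k l. \<bar>int k - int l\<bar> < int i"
  define X where "X k p = x $ (k * r + p)" for k p
  define b where "b k l p q = B $$ (k * r + p, l * r + q)" for k l p q
  define F where "F k l u v = (\<Sum>p<r. \<Sum>q<r. u p * b k l p q * v q)" for k l and u v :: "nat \<Rightarrow> real"
  have bsym: "b k l p q = b l k p q"
    if "k < m" "l < m" "p < r" "q < r" for k l p q
    using block_sym_entries(2)[OF B blocks[OF that(1,2)] that] by (simp add: b_def)
  have Fswap: "F k l u v = F l k u v" if "k < m" "l < m" for k l u v
    unfolding F_def using that by (intro sum.cong refl) (simp add: bsym[of k l])
  have FD: "D k l \<bullet> (block r B k l *\<^sub>v D k l) =
      F k l (X k) (X k) - F k l (X k) (X l) - F k l (X l) (X k) + F k l (X l) (X l)" for k l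
  proof -
    have "D k l \<bullet> (block r B k l *\<^sub>v D k l) = (\<Sum>p<r. \<Sum>q<r. (X k p - X l p) * b k l p q * (X k q - X l q))"
      by (auto simp: D_def X_def b_def block_def scalar_prod_def atLeast0LessThan
          sum_distrib_left mult.assoc intro!: sum.cong)
    also have "\<dots> = F k l (X k) (X k) - F k l (X k) (X l) - F k l (X l) (X k) + F k l (X l) (X l)"
      unfolding F_def sum.distrib[symmetric] sum_subtractf[symmetric]
      by (simp add: algebra_simps)
    finally show ?thesis .
  qed
  have xB: "x \<bullet> (B *\<^sub>v x) = (\<Sum>k<m. \<Sum>l<m. F k l (X k) (X l))"
    unfolding quad_form_blocks[OF B(1) x] F_def X_def b_def ..
  \<comment> \<open>In block row k, the lumped diagonal block contributes one term for each far block of that row.\<close>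
  have xP: "x \<bullet> (?P *\<^sub>v x) =
      (\<Sum>k<m. \<Sum>l<m. if ?near k l then F k l (X k) (X l) else F k l (X k) (X k))"
    unfolding quad_form_blocks[OF block_lumped_carrier x]
  proof (rule sum.cong)
    fix k assume "k \<in> {..<m}"
    then have k: "k < m" by simp
    let ?s = "\<lambda>p q. \<Sum>j<m. if ?near k j then 0 else b k j p q"
    have "(\<Sum>l<m. \<Sum>p<r. \<Sum>q<r. x $ (k * r + p) * ?P $$ (k * r + p, l * r + q) * x $ (l * r + q)) =
      (\<Sum>l<m. if ?near k l then F k l (X k) (X l) else 0) +
      (\<Sum>l<m. if k = l then \<Sum>p<r. \<Sum>q<r. X k p * ?s p q * X k q else 0)"
      unfolding sum.distrib[symmetric] F_def using k
      by (intro sum.cong refl)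
        (auto simp: block_lumped_index[OF B(1)] X_def b_def distrib_left distrib_right sum.distrib cong: if_cong)
    also have "(\<Sum>l<m. if k = l then \<Sum>p<r. \<Sum>q<r. X k p * ?s p q * X k q else 0) =
      (\<Sum>p<r. \<Sum>q<r. \<Sum>j<m. if ?near k j then 0 else X k p * b k j p q * X k q)"
      using k by (auto simp: sum_distrib_left sum_distrib_right intro!: sum.cong)
    also have "\<dots> = (\<Sum>p<r. \<Sum>j<m. \<Sum>q<r. if ?near k j then 0 else X k p * b k j p q * X k q)"
      by (intro sum.cong refl sum.swap)
    also have "\<dots> = (\<Sum>j<m. \<Sum>p<r. \<Sum>q<r. if ?near k j then 0 else X k p * b k j p q * X k q)"
      by (rule sum.swap)
    also have "\<dots> = (\<Sum>j<m. if ?near k j then 0 else F k j (X k) (X k))"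
      unfolding F_def by (intro sum.cong refl) simp
    also have "(\<Sum>l<m. if ?near k l then F k l (X k) (X l) else 0) + \<dots> =
        (\<Sum>l<m. if ?near k l then F k l (X k) (X l) else F k l (X k) (X k))"
      unfolding sum.distrib[symmetric] by (intro sum.cong) auto
    finally show "(\<Sum>l<m. \<Sum>p<r. \<Sum>q<r. x $ (k * r + p) * ?P $$ (k * r + p, l * r + q) * x $ (l * r + q))
      = (\<Sum>l<m. if ?near k l then F k l (X k) (X l) else F k l (X k) (X k))" .
  qed simp
  let ?h = "\<lambda>k l. if ?near k l then 0 else F k l (X k) (X k) - F k l (X k) (X l)"
  have "x \<bullet> (?P *\<^sub>v x) - x \<bullet> (B *\<^sub>v x) = (\<Sum>k<m. \<Sum>l<m. ?h k l)"
    unfolding xP xB sum_subtractf[symmetric] by (intro sum.cong) auto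
  moreover have "(\<Sum>k<m. \<Sum>l<m. ?h k l) = (\<Sum>k<m. \<Sum>l<m. ?h l k)"
    by (rule sum.swap)
  ultimately have "2 * (x \<bullet> (?P *\<^sub>v x) - x \<bullet> (B *\<^sub>v x)) = (\<Sum>k<m. \<Sum>l<m. ?h k l + ?h l k)"
    by (simp add: sum.distrib)
  also have "\<dots> = (\<Sum>k<m. \<Sum>l<m. if ?near k l then 0 else D k l \<bullet> (block r B k l *\<^sub>v D k l))"
  proof (intro sum.cong refl)
    fix k l assume "k \<in> {..<m}" "l \<in> {..<m}"
    then have kl: "k < m" "l < m" by auto
    show "?h k l + ?h l k = (if ?near k l then 0 else D k l \<bullet> (block r B k l *\<^sub>v D k l))"
      unfolding FD Fswap[OF kl(2,1)] by (simp add: abs_minus_commute)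
  qed
  finally show ?thesis by simp
qed

text \<open>The terms in the preceding formula are nonnegative because the blocks are positive semidefinite, and a
larger \<open>i\<close> leaves fewer of them.\<close>

lemma block_lumped_quad_form_antimono:
  fixes B :: "real mat" and x :: "real vec"
  assumes B: "B \<in> carrier_mat (m * r) (m * r)" "B = transpose_mat B"
    and blocks: "\<And>k l. k < m \<Longrightarrow> l < m \<Longrightarrow> block r B k l \<in> sym_psd r"
    and x: "x \<in> carrier_vec (m * r)"
  shows "x \<bullet> (B *\<^sub>v x) \<le> x \<bullet> (block_lumped m r B i *\<^sub>v x)"
    and "i \<le> i' \<Longrightarrow> x \<bullet> (block_lumped m r B i' *\<^sub>v x) \<le> x \<bullet> (block_lumped m r B i *\<^sub>v x)"
proof -
  have nn: "0 \<le> d \<bullet> (block r B k l *\<^sub>v d)" if "k < m" "l < m" "d \<in> carrier_vec r" for k l d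
    using blocks[OF that(1,2)] that(3) unfolding sym_psd_def pos_semidef_def by auto
  define g where "g k l = vec r (\<lambda>p. x $ (k * r + p) - x $ (l * r + p)) \<bullet>
    (block r B k l *\<^sub>v vec r (\<lambda>p. x $ (k * r + p) - x $ (l * r + p)))" for k l
  define S where "S i = (\<Sum>k<m. \<Sum>l<m. if \<bar>int k - int l\<bar> < int i then 0 else g k l)" for i
  have form: "x \<bullet> (block_lumped m r B i *\<^sub>v x) = x \<bullet> (B *\<^sub>v x) + S i / 2" for i
    unfolding S_def g_def by (rule block_lumped_quad_form[OF B blocks x])
  have g: "0 \<le> g k l" if "k < m" "l < m" for k l
    unfolding g_def using that by (intro nn) auto
  have "0 \<le> S i" for i unfolding S_def by (intro sum_nonneg) (auto simp: g)
  then show "x \<bullet> (B *\<^sub>v x) \<le> x \<bullet> (block_lumped m r B i *\<^sub>v x)"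
    unfolding form by simp
  show "x \<bullet> (block_lumped m r B i' *\<^sub>v x) \<le> x \<bullet> (block_lumped m r B i *\<^sub>v x)" if "i \<le> i'"
  proof -
    have "S i' \<le> S i" unfolding S_def using that by (intro sum_mono) (auto simp: g)
    then show ?thesis unfolding form by simp
  qed
qed

section \<open>The spectrum of the block lumped pencils\<close>

lemma S_psd_subset_sym_psd: "S_psd ns \<subseteq> sym_psd (prod_list ns)"
  by (cases ns rule: S_psd.cases) auto

lemma pos_def_imp_pos_semidef:
  assumes "A \<in> carrier_mat n n" "pos_def A"
  shows "pos_semidef A"
  unfolding pos_semidef_def
proof
  fix x :: "real vec" assume "x \<in> carrier_vec (dim_col A)"
  then show "0 \<le> x \<bullet> (A *\<^sub>v x)"
    using assms unfolding pos_def_def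
    by (cases "x = 0\<^sub>v (dim_col A)") (auto intro: less_imp_le)
qed

text \<open>An eigenvalue is the Rayleigh quotient \<open>(x \<bullet> (A *\<^sub>v x)) / (x \<bullet> (P *\<^sub>v x))\<close> of an eigenvector, with
positive numerator and a denominator that is at least as large.\<close>

lemma gen_eigenvalues_in_unit_interval:
  fixes A P :: "real mat"
  assumes A: "A \<in> carrier_mat n n" "pos_def A" and P: "P \<in> carrier_mat n n"
    and le: "\<And>x. x \<in> carrier_vec n \<Longrightarrow> x \<bullet> (A *\<^sub>v x) \<le> x \<bullet> (P *\<^sub>v x)"
  shows "gen_eigenvalues A P \<subseteq> {0<..1}"
proof
  fix c assume "c \<in> gen_eigenvalues A P"
  then obtain x where x: "x \<in> carrier_vec n" "x \<noteq> 0\<^sub>v n" "A *\<^sub>v x = c \<cdot>\<^sub>v (P *\<^sub>v x)"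
    using A unfolding gen_eigenvalues_def by auto
  have "P *\<^sub>v x \<in> carrier_vec n" using P x by simp
  then have eq: "x \<bullet> (A *\<^sub>v x) = c * (x \<bullet> (P *\<^sub>v x))" using x by simp
  have pos: "0 < x \<bullet> (A *\<^sub>v x)" using A x unfolding pos_def_def by auto
  then have "0 < x \<bullet> (P *\<^sub>v x)" using le[OF x(1)] by linarith
  then show "c \<in> {0<..1}"
    using pos le[OF x(1)] unfolding eq by (auto simp: zero_less_mult_iff)
qed

theorem theorem3p17:
  fixes ns :: "nat list" and n :: nat and B :: "real mat" and P :: "nat \<Rightarrow> real mat"
  assumes "length ns \<ge> 2"
    and "\<forall>m \<in> set ns. m \<ge> 1"
    and "n = prod_list ns"
    and "B \<in> S_pd ns"
    and "P = block_lumped (hd ns) (prod_list (tl ns)) B"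
  shows "(\<forall>i \<in> {1..hd ns}. gen_eigenvalues B (P i) \<subseteq> {0<..1}) \<and>
         (\<forall>i \<in> {1..hd ns - 1}. \<forall>k \<in> {1..n}.
            gen_eigenvalue k B (P i) \<le> gen_eigenvalue k B (P (i + 1))) \<and>
         (\<forall>i \<in> {1..hd ns}. gen_eigenvalue n B (P i) = 1)"
proof -
  obtain m m' ms where ns: "ns = m # m' # ms"
    using assms(1) by (metis Suc_le_length_iff numeral_2_eq_2)
  define r where "r = prod_list (m' # ms)"
  have n: "n = m * r" unfolding assms(3) ns r_def by simp
  have P_eq: "P = block_lumped m r B" unfolding assms(5) ns r_def by simp
  have "0 \<notin> set ns" using assms(2) by auto
  then have "n > 0" unfolding assms(3) by (meson gr0I prod_list_zero_iff)
  have "B \<in> sym_pd (m * r)" using assms(4) unfolding ns r_def by simp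
  then have B: "B \<in> carrier_mat n n" "B = transpose_mat B" "pos_def B"
    unfolding sym_pd_def n by auto
  have blocks: "block r B k l \<in> sym_psd r" if "k < m" "l < m" for k l
    using assms(4) that S_psd_subset_sym_psd[of "m' # ms"] unfolding ns r_def by auto
  note lump = B(1,2)[unfolded n] blocks
  have Pc: "P i \<in> carrier_mat n n" for i unfolding P_eq n by (rule block_lumped_carrier)
  have Psym: "P i = transpose_mat (P i)" for i
    unfolding P_eq by (rule block_lumped_sym[OF lump])
  have BP: "x \<bullet> (B *\<^sub>v x) \<le> x \<bullet> (P i *\<^sub>v x)" if "x \<in> carrier_vec n" for x :: "real vec" and i
    using block_lumped_quad_form_antimono(1)[OF lump that[unfolded n]] unfolding P_eq by blast
  have PP: "x \<bullet> (P (i + 1) *\<^sub>v x) \<le> x \<bullet> (P i *\<^sub>v x)" if "x \<in> carrier_vec n" for x :: "real vec" and i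
    using block_lumped_quad_form_antimono(2)[OF lump that[unfolded n]] unfolding P_eq by simp
  have Ppd: "pos_def (P i)" for i
    unfolding pos_def_def
  proof (intro ballI impI)
    fix x :: "real vec" assume "x \<in> carrier_vec (dim_col (P i))" "x \<noteq> 0\<^sub>v (dim_col (P i))"
    then have x: "x \<in> carrier_vec n" "x \<noteq> 0\<^sub>v n" using Pc[of i] by auto
    then have "0 < x \<bullet> (B *\<^sub>v x)" using B unfolding pos_def_def by auto
    then show "0 < x \<bullet> (P i *\<^sub>v x)" using BP[OF x(1), of i] by linarith
  qed
  have range: "gen_eigenvalues B (P i) \<subseteq> {0<..1}" for i
    by (rule gen_eigenvalues_in_unit_interval[OF B(1,3) Pc BP])
  have mono: "gen_eigenvalue k B (P i) \<le> gen_eigenvalue k B (P (i + 1))" if "k \<in> {1..n}" for i k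
    by (rule gen_eigenvalue_antimono[OF B(1,2) pos_def_imp_pos_semidef[OF B(1,3)]
          Pc Psym Ppd Pc Psym Ppd PP that])
  have top: "gen_eigenvalue n B (P i) = 1" for i
  proof (rule gen_eigenvalue_last_eq_Max[OF B(1,2) Pc Psym Ppd \<open>n > 0\<close>])
    let ?e = "vec n (\<lambda>_. 1 :: real)"
    have "?e $ 0 \<noteq> 0\<^sub>v n $ 0" using \<open>n > 0\<close> by simp
    then have "?e \<noteq> 0\<^sub>v n" by metis
    moreover have "B *\<^sub>v ?e = 1 \<cdot>\<^sub>v (P i *\<^sub>v ?e)"
      using block_lumped_row_sums[OF lump(1), of i] unfolding P_eq n by simp
    ultimately show "1 \<in> gen_eigenvalues B (P i)"
      using B(1) unfolding gen_eigenvalues_def by (auto intro!: bexI[of _ ?e])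
  qed (use range[of i] in fastforce)
  show ?thesis by (intro conjI ballI range mono top)
qed

end
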